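(* Let $l\in\mathbb{N}$, $\mathbf{p}=(p_1,\dots,p_l)\in\mathbb{N}^l$, $p=p_1+\cdots+p_l$, $\mathbf{h}\in\mathbb{C}^l$ and $a,b,d,e\in\mathbb{C}$ be such that both series below terminate. Then $$ F\left(\begin{matrix}a,b,d,\mathbf{h}+\mathbf{p}\\(a+b+1)/2,\;e,\;\mathbf{h}\end{matrix}\right) =\frac{\Gamma(e-d)}{(1-e+d)_{p}\,(\mathbf{h})_{\mathbf{p}}}\, F\left(\begin{matrix}a/2,\;b/2,\;d,\;e-d-p\\(a+b+1)/2,\;\Delta(e,2)\end{matrix}\;\vdots\;Y_p(1,-1)\right), $$ where $Y_p(1,-1)$ denotes the polynomial $t\mapsto Y_p(1,-1;t)$ (defined in the context) with $\lambda=0$.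
   Context: Notation: $(a)_n=\Gamma(a+n)/\Gamma(a)$; for vectors, $(\mathbf{a})_n=\prod_j(a_j)_n$, $(\mathbf{h})_{\mathbf{p}}=\prod_i(h_i)_{p_i}$, and $\mathbf{a}+\beta$ means adding $\beta$ to each component. $\Delta(a,2)=(a/2,(a+1)/2)$. For a polynomial $P$, $$F\left(\begin{matrix}\mathbf{a}\\\mathbf{b}\end{matrix}\;\vdots\;P\right)=\sum_{n\ge0}\frac{(\mathbf{a})_n}{(\mathbf{b})_n\,n!}P(n),$$ with $P\equiv1$ when omitted (unit argument). A series terminates if one of its upper parameters is a non-positive integer. Standing convention: lower parameters are never non-positive integers, and all Gamma functions are defined and all denominators non-zero. $$ Y_p(u,v;t)=\frac{(\mathbf{h}-d)_{\mathbf{p}}}{\Gamma(e-d)}\sum_{j=0}^{p}\frac{(d-e+1)_{j}}{j!}\,F\left(\begin{matrix}-j,1-\mathbf{h}+d\\1-\mathbf{h}+d-\mathbf{p}\end{matrix}\right)(ut+d)_{j}\,(vt+d-e-\lambda+j+1)_{p-j}. $$ *)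

theory Defs
  imports "HOL-Analysis.Analysis"
begin

text \<open>
  Parameter vectors are lists of complex numbers. The Pochhammer symbol is the library's
  rising factorial \<^const>\<open>pochhammer\<close>, which is the quotient of Gamma values wherever that
  quotient is defined and its usual continuation where the upper parameter is a non-positive
  integer.
\<close>

definition vec_poch :: "complex list \<Rightarrow> nat \<Rightarrow> complex" where
  "vec_poch as n = (\<Prod>a\<leftarrow>as. pochhammer a n)"

definition multi_poch :: "complex list \<Rightarrow> nat list \<Rightarrow> complex" where
  "multi_poch h p = (\<Prod>(x, k)\<leftarrow>zip h p. pochhammer x k)"

definition shift :: "complex list \<Rightarrow> complex \<Rightarrow> complex list" where
  "shift h \<beta> = map (\<lambda>x. x + \<beta>) h"

definition vadd :: "complex list \<Rightarrow> nat list \<Rightarrow> complex list" where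
  "vadd h p = map2 (\<lambda>x k. x + of_nat k) h p"

definition \<Delta>2 :: "complex \<Rightarrow> complex list" where
  "\<Delta>2 a = [a / 2, (a + 1) / 2]"

text \<open>
  The series is meaningful when it is summable, in particular when it terminates and no lower
  parameter is a non-positive integer (see the two predicates below).
\<close>

definition hypF_poly :: "complex list \<Rightarrow> complex list \<Rightarrow> (complex \<Rightarrow> complex) \<Rightarrow> complex" where
  "hypF_poly as bs P = (\<Sum>n. vec_poch as n / (vec_poch bs n * fact n) * P (of_nat n))"

definition hypF :: "complex list \<Rightarrow> complex list \<Rightarrow> complex" where
  "hypF as bs = hypF_poly as bs (\<lambda>_. 1)"

definition terminating :: "complex list \<Rightarrow> bool" where
  "terminating as \<longleftrightarrow> (\<exists>a\<in>set as. a \<in> \<int>\<^sub>\<le>\<^sub>0)"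

definition admissible_lower :: "complex list \<Rightarrow> bool" where
  "admissible_lower bs \<longleftrightarrow> (\<forall>b\<in>set bs. b \<notin> \<int>\<^sub>\<le>\<^sub>0)"

definition Y_upper :: "complex \<Rightarrow> complex list \<Rightarrow> complex list" where
  "Y_upper d h = map (\<lambda>x. 1 - x + d) h"

definition Y_lower :: "complex \<Rightarrow> complex list \<Rightarrow> nat list \<Rightarrow> complex list" where
  "Y_lower d h p = map2 (\<lambda>x k. 1 - x + d - of_nat k) h p"

text \<open>The argument \<open>\<Lambda>\<close> is the parameter usually written as a lower-case lambda.\<close>

definition Y :: "complex \<Rightarrow> complex \<Rightarrow> complex \<Rightarrow> complex list \<Rightarrow> nat list \<Rightarrow>
    complex \<Rightarrow> complex \<Rightarrow> complex \<Rightarrow> complex" where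
  "Y d e \<Lambda> h p u v t =
     multi_poch (shift h (- d)) p / Gamma (e - d) *
     (\<Sum>j=0..sum_list p.
        pochhammer (d - e + 1) j / fact j *
        hypF (- of_nat j # Y_upper d h) (Y_lower d h p) *
        pochhammer (u * t + d) j *
        pochhammer (v * t + d - e - \<Lambda> + of_nat j + 1) (sum_list p - j))"

end

theory Submission
  imports Defs
begin

text \<open>
  Write \<open>c = (a + b + 1)/2\<close>. Gauss's quadratic transformation
  \<open>F(a, b; c; z) = F(a/2, b/2; c; 4z(1 - z))\<close> holds as an identity of formal power series,
  because both sides satisfy the same hypergeometric differential equation. Apply to it the linear
  functional sending \<open>z ^ n\<close> to \<open>(d)\<^sub>n (h + p)\<^sub>n / ((e)\<^sub>n (h)\<^sub>n)\<close>: the left-hand side becomes the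
  series on the left of the theorem. On the right, \<open>(h + p)\<^sub>n / (h)\<^sub>n = (h + n)\<^sub>p / (h)\<^sub>p\<close> is a
  polynomial in \<open>n\<close>, whose Newton expansion at the nodes \<open>n = - d - i\<close> has as its coefficients
  the terminating series in the definition of \<open>Y\<close>; the value of the functional at
  \<open>(z(1 - z)) ^ t\<close> then follows from the Chu-Vandermonde sum applied to each Newton basis element.
\<close>

unbundle fps_syntax and no vec_syntax

section \<open>Formal hypergeometric series and Gauss's quadratic transformation\<close>

text \<open>Taken as a formal series, so that the quadratic transformation holds for all parameters
  with admissible \<open>c\<close>; termination matters only once the functional is applied.\<close>

definition hyp2F1_fps :: "'a::field_char_0 \<Rightarrow> 'a \<Rightarrow> 'a \<Rightarrow> 'a fps" where
  "hyp2F1_fps a b c =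
     Abs_fps (\<lambda>n. pochhammer a n * pochhammer b n / (pochhammer c n * fact n))"

text \<open>Each coefficient of the hypergeometric equation links just two neighbouring coefficients
  of \<open>G\<close>, so the equation amounts to a first-order recursion.\<close>

lemma hypergeometric_ode_nth:
  fixes G :: "'a::field_char_0 fps"
  shows "(fps_X * (1 - fps_X) * fps_deriv (fps_deriv G)
       + (fps_const c - fps_const (a + b + 1) * fps_X) * fps_deriv G) $ n
     - (fps_const (a * b) * G) $ n
   = of_nat (Suc n) * (c + of_nat n) * G $ Suc n - (a + of_nat n) * (b + of_nat n) * G $ n"
proof (cases n)
  case 0
  then show ?thesis by (simp add: algebra_simps mult.assoc)
next
  case (Suc m)
  then show ?thesis
    by (simp add: algebra_simps mult.assoc fps_X_mult_nth)
qed

text \<open>The recursion can be solved for \<open>G $ Suc n\<close> because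
  \<open>c + of_nat n\<close> never vanishes, so the constant term determines a formal solution.
  Both directions serve below: one yields the equation of a known series, the other recognises a
  series from its equation.\<close>

lemma hypergeometric_ode_iff:
  fixes G :: "'a::field_char_0 fps"
  assumes c: "c \<notin> \<int>\<^sub>\<le>\<^sub>0"
  shows "fps_X * (1 - fps_X) * fps_deriv (fps_deriv G)
       + (fps_const c - fps_const (a + b + 1) * fps_X) * fps_deriv G = fps_const (a * b) * G
     \<longleftrightarrow> G = fps_const (G $ 0) * hyp2F1_fps a b c"
  (is "?L = ?R \<longleftrightarrow> _")
proof -
  have nz: "c + of_nat n \<noteq> 0" "pochhammer c n \<noteq> 0" for n
    using c by (auto simp: add_eq_0_iff2 pochhammer_eq_0_iff)
  have "?L = ?R \<longleftrightarrow> (\<forall>n. ?L $ n - ?R $ n = 0)"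
    by (simp add: fps_eq_iff)
  also have "\<dots> \<longleftrightarrow> (\<forall>n. G $ Suc n =
      (a + of_nat n) * (b + of_nat n) / (of_nat (Suc n) * (c + of_nat n)) * G $ n)"
  proof (intro all_cong1)
    fix n
    have "x * u - y * v = 0 \<longleftrightarrow> u = y / x * v" if "x \<noteq> 0" for x y u v :: 'a
      using that by (auto simp: field_simps)
    then show "?L $ n - ?R $ n = 0 \<longleftrightarrow>
      G $ Suc n = (a + of_nat n) * (b + of_nat n) / (of_nat (Suc n) * (c + of_nat n)) * G $ n"
      unfolding hypergeometric_ode_nth using nz by (simp del: of_nat_Suc)
  qed
  also have "\<dots> \<longleftrightarrow> (\<forall>n. G $ n = G $ 0 * hyp2F1_fps a b c $ n)"
  proof safe
    fix n assume rec: "\<forall>n. G $ Suc n =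
      (a + of_nat n) * (b + of_nat n) / (of_nat (Suc n) * (c + of_nat n)) * G $ n"
    show "G $ n = G $ 0 * hyp2F1_fps a b c $ n"
    proof (induction n)
      case (Suc n)
      then show ?case
        using nz[of n] by (subst rec[rule_format]) (simp add: hyp2F1_fps_def pochhammer_Suc mult_ac)
    qed (simp add: hyp2F1_fps_def)
  next
    fix n assume *: "\<forall>n. G $ n = G $ 0 * hyp2F1_fps a b c $ n"
    show "G $ Suc n =
      (a + of_nat n) * (b + of_nat n) / (of_nat (Suc n) * (c + of_nat n)) * G $ n"
      using nz[of n] unfolding *[rule_format, of n] *[rule_format, of "Suc n"]
      by (simp add: hyp2F1_fps_def pochhammer_Suc mult_ac)
  qed
  also have "\<dots> \<longleftrightarrow> G = fps_const (G $ 0) * hyp2F1_fps a b c"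
    by (simp add: fps_eq_iff)
  finally show ?thesis .
qed

text \<open>For w = 4z(1 - z) one has 1 - w = (1 - 2z)^2. By the chain rule the equation with
  parameters \<alpha>, \<beta>, c then pulls back to the one with 2\<alpha>, 2\<beta>, c, thanks to
  2c = 2\<alpha> + 2\<beta> + 1; both series have constant term 1.\<close>

lemma hyp2F1_fps_quadratic:
  fixes \<alpha> \<beta> :: "'a::field_char_0"
  defines "c \<equiv> \<alpha> + \<beta> + 1 / 2"
  assumes c: "c \<notin> \<int>\<^sub>\<le>\<^sub>0"
  shows "hyp2F1_fps \<alpha> \<beta> c oo (4 * fps_X * (1 - fps_X)) = hyp2F1_fps (2 * \<alpha>) (2 * \<beta>) c"
proof -
  define w :: "'a fps" where "w = 4 * fps_X * (1 - fps_X)"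
  define F where "F = hyp2F1_fps \<alpha> \<beta> c"
  define G where "G = F oo w"
  define F1 where "F1 = fps_deriv F oo w"
  define F2 where "F2 = fps_deriv (fps_deriv F) oo w"
  have w0: "w $ 0 = 0" by (simp add: w_def mult.assoc)
  have F0: "F $ 0 = 1" by (simp add: F_def hyp2F1_fps_def)
  have dw: "fps_deriv w = 4 * (1 - 2 * fps_X)"
    by (simp add: w_def algebra_simps)
  have dG: "fps_deriv G = F1 * fps_deriv w"
    unfolding G_def F1_def by (rule fps_compose_deriv[OF w0])
  have ddG: "fps_deriv (fps_deriv G) = F2 * (fps_deriv w)\<^sup>2 - 8 * F1"
  proof -
    have "fps_deriv F1 = F2 * fps_deriv w"
      unfolding F1_def F2_def by (rule fps_compose_deriv[OF w0])
    moreover have "fps_deriv (fps_deriv w) = - 8"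
      by (simp add: dw)
    ultimately show ?thesis
      by (simp add: dG power2_eq_square mult_ac)
  qed
  have "fps_X * (1 - fps_X) * fps_deriv (fps_deriv F)
       + (fps_const c - fps_const (\<alpha> + \<beta> + 1) * fps_X) * fps_deriv F = fps_const (\<alpha> * \<beta>) * F"
    using hypergeometric_ode_iff[OF c, of F \<alpha> \<beta>] F0 by (simp add: F_def)
  from arg_cong[OF this, of "\<lambda>f. f oo w"]
  have ode: "w * (1 - w) * F2 + (fps_const c - fps_const (\<alpha> + \<beta> + 1) * w) * F1 = fps_const (\<alpha> * \<beta>) * G"
    using w0 by (simp add: fps_compose_add_distrib fps_compose_sub_distrib
        fps_compose_mult_distrib F1_def F2_def G_def)
  \<comment> \<open>As named series the constants are plain ring elements for
    \<open>algebra\<close>; the relation proved next is all it has to know about them.\<close>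
  define C A B :: "'a fps" where "C = fps_const c" and "A = fps_const \<alpha>" and "B = fps_const \<beta>"
  have C: "2 * C = 2 * A + 2 * B + 1"
  proof -
    have "fps_const (2 * c) = fps_const (2 * \<alpha> + 2 * \<beta> + 1)"
      by (simp add: c_def)
    then show ?thesis
      by (simp add: C_def A_def B_def numeral_fps_const)
  qed
  have ode': "w * (1 - w) * F2 + (C - (A + B + 1) * w) * F1 = A * B * G"
    using ode by (simp add: C_def A_def B_def flip: fps_const_add fps_const_mult)
  \<comment> \<open>This is four times \<open>ode'\<close>: X(1 - X)w'^2 = 4w(1 - w), and the
    relation \<open>C\<close> matches the coefficients of \<open>F1\<close>.\<close>
  have "fps_X * (1 - fps_X) * (F2 * (4 * (1 - 2 * fps_X))\<^sup>2 - 8 * F1)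
       + (C - (2 * A + 2 * B + 1) * fps_X) * (F1 * (4 * (1 - 2 * fps_X))) = (2 * A) * (2 * B) * G"
    using ode' C unfolding w_def by algebra
  then have "fps_X * (1 - fps_X) * fps_deriv (fps_deriv G)
       + (fps_const c - fps_const (2 * \<alpha> + 2 * \<beta> + 1) * fps_X) * fps_deriv G
     = fps_const ((2 * \<alpha>) * (2 * \<beta>)) * G"
    unfolding ddG
    unfolding dG dw C_def A_def B_def
    by (simp add: numeral_fps_const flip: fps_const_add fps_const_mult)
  then show ?thesis
    using hypergeometric_ode_iff[OF c, of G "2 * \<alpha>" "2 * \<beta>"] F0
    by (simp add: G_def F_def w_def)
qed

text \<open>The power is 4^i X^i (1 - X)^i, with degrees from i to 2i. The lower cutoff is explicit
  because \<open>n - i\<close> truncates at 0; the upper one is the vanishing of the binomial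
  coefficient.\<close>

lemma quadratic_power_nth:
  "((4 * fps_X * (1 - fps_X)) ^ i :: 'a::field_char_0 fps) $ n =
     (if n < i then 0 else 4 ^ i * (- 1) ^ (n - i) * of_nat (i choose (n - i)))"
proof -
  have "(1 - fps_X :: 'a fps) ^ i = (\<Sum>k\<le>i. fps_const ((- 1) ^ k * of_nat (i choose k)) * fps_X ^ k)"
    using binomial_ring[of "- fps_X" "1 :: 'a fps" i]
    by (simp add: power_minus[of fps_X] fps_of_nat ac_simps
        flip: fps_const_mult fps_const_neg fps_const_power)
  then have *: "((1 - fps_X :: 'a fps) ^ i) $ k = (- 1) ^ k * of_nat (i choose k)" for k
    by (simp add: fps_sum_nth if_distrib[of "\<lambda>x. _ * x"] cong: if_cong)
  have "(4 * fps_X * (1 - fps_X)) ^ i = fps_const (4 ^ i :: 'a) * (fps_X ^ i * (1 - fps_X) ^ i)"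
    by (simp add: power_mult_distrib numeral_fps_const mult.assoc)
  then show ?thesis
    by (simp only: fps_mult_left_const_nth fps_X_power_mult_nth *) simp
qed

lemma hyp2F1_fps_quadratic_coeff:
  fixes \<alpha> \<beta> :: "'a::field_char_0"
  defines "c \<equiv> \<alpha> + \<beta> + 1 / 2"
  assumes "c \<notin> \<int>\<^sub>\<le>\<^sub>0"
  shows "hyp2F1_fps (2 * \<alpha>) (2 * \<beta>) c $ n =
    (\<Sum>i\<le>n. hyp2F1_fps \<alpha> \<beta> c $ i * (4 ^ i * (- 1) ^ (n - i) * of_nat (i choose (n - i))))"
proof -
  have "hyp2F1_fps (2 * \<alpha>) (2 * \<beta>) c $ n
      = (hyp2F1_fps \<alpha> \<beta> c oo (4 * fps_X * (1 - fps_X))) $ n"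
    using hyp2F1_fps_quadratic[of \<alpha> \<beta>] assms by simp
  then show ?thesis
    by (simp add: fps_compose_nth quadratic_power_nth atLeast0AtMost)
qed

section \<open>Binomial inversion and Newton interpolation\<close>

text \<open>The matrix of signed binomial coefficients is its own inverse:
  \<open>choose_mult\<close> turns each entry of its square into a multiple of an alternating row
  sum of Pascal's triangle, which vanishes off the diagonal.\<close>

lemma binomial_inversion:
  fixes f :: "nat \<Rightarrow> 'a::comm_ring_1"
  shows "(\<Sum>j\<le>m. (- 1) ^ j * of_nat (m choose j) *
     (\<Sum>i\<le>j. (- 1) ^ i * of_nat (j choose i) * f i)) = f m"
proof -
  have *: "(\<Sum>j=i..m. (- 1) ^ j * of_nat (m choose j) * ((- 1) ^ i * of_nat (j choose i)))
      = (if i = m then 1 else 0 :: 'a)" if "i \<le> m" for i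
  proof -
    have "(\<Sum>j=i..m. (- 1) ^ j * of_nat (m choose j) * ((- 1) ^ i * of_nat (j choose i)))
        = (\<Sum>j=i..m. (- 1) ^ (j + i) * of_nat ((m choose j) * (j choose i)) :: 'a)"
      by (simp add: power_add ac_simps)
    also have "\<dots> = (\<Sum>k\<le>m - i. (- 1) ^ (k + i + i) * of_nat ((m choose (k + i)) * ((k + i) choose i)))"
      by (rule sum.reindex_bij_witness[of _ "\<lambda>k. k + i" "\<lambda>j. j - i"]) (use that in auto)
    also have "\<dots> = (\<Sum>k\<le>m - i. of_nat (m choose i) * ((- 1) ^ k * of_nat ((m - i) choose k)))"
    proof (rule sum.cong[OF refl])
      fix k assume "k \<in> {..m - i}"
      then have "(m choose (k + i)) * ((k + i) choose i) = (m choose i) * ((m - i) choose k)"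
        using choose_mult[of i "k + i" m] that by simp
      then show "(- 1) ^ (k + i + i) * of_nat ((m choose (k + i)) * ((k + i) choose i))
          = of_nat (m choose i) * ((- 1) ^ k * of_nat ((m - i) choose k) :: 'a)"
        by (simp add: power_add mult.assoc flip: power_mult_distrib)
    qed
    also have "\<dots> = (if i = m then 1 else 0)"
      using that choose_alternating_sum[of "m - i", where 'a = 'a]
      by (auto simp flip: sum_distrib_left)
    finally show ?thesis .
  qed
  have "(\<Sum>j\<le>m. (- 1) ^ j * of_nat (m choose j) * (\<Sum>i\<le>j. (- 1) ^ i * of_nat (j choose i) * f i))
      = (\<Sum>j\<le>m. \<Sum>i\<le>m. (- 1) ^ j * of_nat (m choose j) * ((- 1) ^ i * of_nat (j choose i)) * f i)"
    unfolding sum_distrib_left mult.assoc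
    by (rule sum.cong[OF refl], rule sum.mono_neutral_left) (simp_all add: binomial_eq_0)
  also have "\<dots> = (\<Sum>i\<le>m. \<Sum>j\<le>m. (- 1) ^ j * of_nat (m choose j) * ((- 1) ^ i * of_nat (j choose i)) * f i)"
    by (rule sum.swap)
  also have "\<dots> = (\<Sum>i\<le>m. \<Sum>j=i..m. (- 1) ^ j * of_nat (m choose j) * ((- 1) ^ i * of_nat (j choose i)) * f i)"
    by (rule sum.cong[OF refl], rule sum.mono_neutral_right) (auto simp: binomial_eq_0 not_le)
  also have "\<dots> = (\<Sum>i\<le>m. (if i = m then 1 else 0) * f i)"
    by (simp add: * flip: sum_distrib_right)
  also have "\<dots> = f m"
    by (simp add: if_distrib[of "\<lambda>x. x * _"] cong: if_cong)
  finally show ?thesis .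
qed

lemma pochhammer_poly:
  fixes c :: "'a::idom"
  shows "\<exists>q. degree q \<le> n \<and> (\<forall>y. poly q y = pochhammer (c - y) n)"
proof (intro exI conjI allI)
  show "degree (\<Prod>k<n. [:c + of_nat k, - 1:]) \<le> n"
    by (rule order_trans[OF degree_prod_sum_le]) auto
  show "poly (\<Prod>k<n. [:c + of_nat k, - 1:]) y = pochhammer (c - y) n" for y
    by (simp add: poly_prod pochhammer_prod atLeast0LessThan algebra_simps)
qed

lemma pochhammer_neg_of_nat:
  assumes "j \<le> m"
  shows "pochhammer (- of_nat m) j = (- 1) ^ j * fact j * (of_nat (m choose j) :: 'a::field_char_0)"
proof -
  have "of_nat (m choose j) = (- 1) ^ j * pochhammer (- of_nat m :: 'a) j / fact j"
    by (simp add: gbinomial_pochhammer binomial_gbinomial)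
  then show ?thesis by (simp flip: power_mult_distrib)
qed

text \<open>Both sides are polynomials of degree at most p in -x, so agreement at 0, ..., p
  suffices. At the node m, (-m)_j = (-1)^j j! C(m, j) reduces the claim to binomial
  inversion.\<close>

lemma newton_expansion:
  fixes R :: "'a::field_char_0 poly"
  assumes "degree R \<le> p"
  shows "poly R (- x) =
    (\<Sum>j\<le>p. pochhammer x j / fact j * (\<Sum>i\<le>j. (- 1) ^ i * of_nat (j choose i) * poly R (of_nat i)))"
proof -
  define E where "E j = (\<Sum>i\<le>j. (- 1) ^ i * of_nat (j choose i) * poly R (of_nat i))" for j
  obtain q :: "nat \<Rightarrow> 'a poly" where q: "\<And>j. degree (q j) \<le> j" "\<And>j y. poly (q j) y = pochhammer (- y) j"
    using pochhammer_poly[where c = "0 :: 'a"] unfolding diff_0 by metis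
  define S where "S = (\<Sum>j\<le>p. smult (E j / fact j) (q j))"
  have deg: "degree S \<le> p"
    unfolding S_def by (intro degree_sum_le) (auto intro: order_trans[OF degree_smult_le] order_trans[OF q(1)])
  have S: "poly S y = (\<Sum>j\<le>p. pochhammer (- y) j / fact j * E j)" for y
    by (simp add: S_def poly_sum q mult.commute)
  have "poly S (of_nat m) = poly R (of_nat m)" if "m \<le> p" for m
  proof -
    have "poly S (of_nat m) = (\<Sum>j\<le>m. pochhammer (- of_nat m) j / fact j * E j)"
      unfolding S using that
      by (intro sum.mono_neutral_right) (auto simp: pochhammer_of_nat_eq_0_iff)
    also have "\<dots> = (\<Sum>j\<le>m. (- 1) ^ j * of_nat (m choose j) * E j)"
      by (intro sum.cong) (auto simp: pochhammer_neg_of_nat)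
    also have "\<dots> = poly R (of_nat m)"
      unfolding E_def by (rule binomial_inversion)
    finally show ?thesis .
  qed
  then have "S = R"
    using deg assms
    by (intro poly_eqI_degree[of "of_nat ` {..p}"]) (auto simp: card_image inj_on_def)
  then show ?thesis
    using S[of "- x"] by (simp add: E_def)
qed

section \<open>Pochhammer identities and the Chu-Vandermonde sum\<close>

lemma pochhammer_one_minus:
  "pochhammer (1 - z) n = (- 1) ^ n * pochhammer (z - of_nat n) n" for z :: "'a::comm_ring_1"
  using pochhammer_minus[of "z - 1" n] by (simp add: algebra_simps)

text \<open>Reflecting both factors of length i produces the same sign; what remains are two ways of
  splitting (y - i)_{i+k}.\<close>

lemma pochhammer_reflect_swap:
  fixes y :: "'a::comm_ring_1"
  shows "pochhammer (1 - y) i * pochhammer y k = pochhammer (1 - y - of_nat k) i * pochhammer (y - of_nat i) k"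
proof -
  have "pochhammer (y - of_nat i) i * pochhammer y k
      = pochhammer (y - of_nat i) k * pochhammer (y + of_nat k - of_nat i) i"
    using pochhammer_product'[of "y - of_nat i" i k] pochhammer_product'[of "y - of_nat i" k i]
    by (simp add: add.commute algebra_simps)
  moreover have "1 - y - of_nat k = 1 - (y + of_nat k)"
    by simp
  ultimately show ?thesis
    by (simp only: pochhammer_one_minus mult.assoc mult.left_commute)
      (simp add: mult_ac)
qed

text \<open>For x = 1 - e + d this trades (e - d - j)_t for (e - d - p)_t, which does not depend on
  j and can leave the Newton sum.\<close>

lemma pochhammer_split_shifted:
  fixes x :: "'a::comm_ring_1"
  assumes "j \<le> p"
  shows "pochhammer x j * pochhammer (x + of_nat j - of_nat t) (p - j) * pochhammer (1 - x - of_nat p) t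
       = pochhammer (1 - x - of_nat j) t * pochhammer x p"
  using pochhammer_reflect_swap[of "x + of_nat j" t "p - j"] pochhammer_product[OF assms, of x] assms
  by (simp add: algebra_simps of_nat_diff)

text \<open>The functional at (z(1 - z))^t for one Newton basis element, as (d)_n (d + n)_j =
  (d)_{n+j}. Without its k = 0 term as a factor, the sum is Chu-Vandermonde with upper parameters
  -t, d + t + j and lower parameter e + t.\<close>

lemma alternating_pochhammer_ratio_sum:
  fixes d e :: complex
  assumes e: "e \<notin> \<int>\<^sub>\<le>\<^sub>0"
  shows "(\<Sum>k\<le>t. (- 1) ^ k * of_nat (t choose k) * (pochhammer d (t + k + j) / pochhammer e (t + k)))
       = pochhammer d (t + j) * pochhammer (e - d - of_nat j) t / pochhammer e (2 * t)"
proof -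
  have nz: "pochhammer e n \<noteq> 0" for n
    using e by (auto simp: pochhammer_eq_0_iff)
  have nz': "pochhammer (e + of_nat t) k \<noteq> 0" for k
    using nz[of "t + k"] by (simp add: pochhammer_product')
  have "(\<Sum>k\<le>t. (- 1) ^ k * of_nat (t choose k) * (pochhammer d (t + k + j) / pochhammer e (t + k)))
      = (\<Sum>k\<le>t. pochhammer d (t + j) / pochhammer e t *
          (pochhammer (d + of_nat (t + j)) k * pochhammer (- of_nat t) k
            / (of_nat (fact k) * pochhammer (e + of_nat t) k)))"
  proof (rule sum.cong[OF refl])
    fix k assume "k \<in> {..t}"
    then have "(- 1) ^ k * of_nat (t choose k) = pochhammer (- of_nat t) k / (fact k :: complex)"
      by (simp add: pochhammer_neg_of_nat)
    moreover have "pochhammer d (t + k + j) = pochhammer d (t + j) * pochhammer (d + of_nat (t + j)) k"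
      using pochhammer_product'[of d "t + j" k] by (simp add: ac_simps)
    ultimately show "(- 1) ^ k * of_nat (t choose k) * (pochhammer d (t + k + j) / pochhammer e (t + k))
      = pochhammer d (t + j) / pochhammer e t *
          (pochhammer (d + of_nat (t + j)) k * pochhammer (- of_nat t) k
            / (of_nat (fact k) * pochhammer (e + of_nat t) k))"
      by (simp only: pochhammer_product'[of e t k]) (simp add: mult_ac)
  qed
  also have "\<dots> = pochhammer d (t + j) / pochhammer e t *
      (pochhammer (e + of_nat t - (d + of_nat (t + j))) t / pochhammer (e + of_nat t) t)"
    unfolding sum_distrib_left[symmetric] atMost_atLeast0
    using nz' by (subst Vandermonde_pochhammer) (auto simp: pochhammer_eq_0_iff)
  also have "\<dots> = pochhammer d (t + j) * pochhammer (e - d - of_nat j) t / pochhammer e (2 * t)"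
    unfolding mult_2 pochhammer_product' by (simp add: algebra_simps)
  finally show ?thesis .
qed

section \<open>Parameter vectors and the Newton coefficients in \<open>Y\<close>\<close>

lemma vec_poch_simps [simp]:
  "vec_poch [] n = 1" "vec_poch (x # xs) n = pochhammer x n * vec_poch xs n"
  by (simp_all add: vec_poch_def)

lemma vec_poch_append [simp]: "vec_poch (xs @ ys) n = vec_poch xs n * vec_poch ys n"
  by (simp add: vec_poch_def)

lemma vec_poch_nonzero: "admissible_lower bs \<Longrightarrow> vec_poch bs n \<noteq> 0"
  by (induction bs) (auto simp: admissible_lower_def pochhammer_eq_0_iff)

lemma multi_poch_simps [simp]:
  "multi_poch [] [] = 1" "multi_poch (x # xs) (k # ks) = pochhammer x k * multi_poch xs ks"
  by (simp_all add: multi_poch_def)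

lemma shift_simps [simp]: "shift [] \<beta> = []" "shift (x # xs) \<beta> = (x + \<beta>) # shift xs \<beta>"
  by (simp_all add: shift_def)

text \<open>Componentwise, both sides split (x)_{n+k}. This makes the parameter pairs h + p over h a
  polynomial in n.\<close>

lemma vec_poch_vadd:
  assumes "length h = length p"
  shows "vec_poch (vadd h p) n * multi_poch h p = vec_poch h n * multi_poch (shift h (of_nat n)) p"
  using assms
proof (induction h p rule: list_induct2)
  case (Cons x xs k ks)
  have "pochhammer (x + of_nat k) n * pochhammer x k = pochhammer x n * pochhammer (x + of_nat n) k"
    by (metis add.commute mult.commute pochhammer_product')
  with Cons.IH show ?case
    by (simp add: vadd_def) algebra
qed (simp add: vadd_def)

text \<open>Turns the i-th term of the inner series of \<open>Y\<close> into the value of (h + n)_p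
  at the node n = -d - i.\<close>

lemma vec_poch_Y_upper:
  assumes "length h = length p"
  shows "vec_poch (Y_upper d h) i * multi_poch (shift h (- d)) p
       = vec_poch (Y_lower d h p) i * multi_poch (shift h (- d - of_nat i)) p"
  using assms
proof (induction h p rule: list_induct2)
  case (Cons x xs k ks)
  have "pochhammer (1 - x + d) i * pochhammer (x - d) k
      = pochhammer (1 - x + d - of_nat k) i * pochhammer (x - d - of_nat i) k"
    using pochhammer_reflect_swap[of "x - d" i k] by (simp add: algebra_simps)
  with Cons.IH show ?case
    by (simp add: Y_upper_def Y_lower_def add_diff_eq) algebra
qed (simp add: Y_upper_def Y_lower_def)

lemma multi_poch_shift_poly:
  assumes "length h = length p"
  shows "\<exists>q. degree q \<le> sum_list p \<and> (\<forall>y. poly q y = multi_poch (shift h (c - y)) p)"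
  using assms
proof (induction h p rule: list_induct2)
  case Nil
  then show ?case by (intro exI[of _ 1]) simp
next
  case (Cons x xs k ks)
  then obtain q where q: "degree q \<le> sum_list ks" "\<And>y. poly q y = multi_poch (shift xs (c - y)) ks"
    by blast
  obtain r where r: "degree r \<le> k" "\<And>y. poly r y = pochhammer (x + c - y) k"
    using pochhammer_poly by blast
  have "degree (r * q) \<le> sum_list (k # ks)"
    using degree_mult_le[of r q] q(1) r(1) by simp
  then show ?case
    by (intro exI[of _ "r * q"]) (simp add: q r add_diff_eq)
qed

text \<open>The factor (-j)_i cuts the series off after i = j and supplies the signed binomials, so
  the series is, up to sign and normalisation, a j-th finite difference.\<close>

lemma hypF_Y_eq_difference:
  assumes len: "length h = length p" and adm: "admissible_lower (Y_lower d h p)"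
  shows "multi_poch (shift h (- d)) p * hypF (- of_nat j # Y_upper d h) (Y_lower d h p)
       = (\<Sum>i\<le>j. (- 1) ^ i * of_nat (j choose i) * multi_poch (shift h (- d - of_nat i)) p)"
proof -
  have "hypF (- of_nat j # Y_upper d h) (Y_lower d h p)
      = (\<Sum>i\<le>j. vec_poch (- of_nat j # Y_upper d h) i / (vec_poch (Y_lower d h p) i * fact i))"
    unfolding hypF_def hypF_poly_def
    by (subst suminf_finite[of "{..j}"]) (auto simp: pochhammer_of_nat_eq_0_iff)
  then show ?thesis
  proof (simp only: sum_distrib_left, intro sum.cong[OF refl])
    fix i assume i: "i \<in> {..j}"
    show "multi_poch (shift h (- d)) p *
        (vec_poch (- of_nat j # Y_upper d h) i / (vec_poch (Y_lower d h p) i * fact i)) =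
      (- 1) ^ i * of_nat (j choose i) * multi_poch (shift h (- d - of_nat i)) p"
      using vec_poch_Y_upper[OF len, of d i] vec_poch_nonzero[OF adm, of i] i
      by (simp add: pochhammer_neg_of_nat field_simps)
  qed
qed

text \<open>Newton expansion of y \<mapsto> (h - d - y)_p, evaluated at y = -(d + n).\<close>

lemma multi_poch_newton:
  assumes len: "length h = length p" and adm: "admissible_lower (Y_lower d h p)"
  shows "multi_poch (shift h (of_nat n)) p =
    (\<Sum>j\<le>sum_list p. pochhammer (d + of_nat n) j / fact j *
       (multi_poch (shift h (- d)) p * hypF (- of_nat j # Y_upper d h) (Y_lower d h p)))"
proof -
  obtain q where q: "degree q \<le> sum_list p" "\<And>y. poly q y = multi_poch (shift h (- d - y)) p"
    using multi_poch_shift_poly[OF len] by blast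
  show ?thesis
    using newton_expansion[OF q(1), of "d + of_nat n"]
    by (simp add: q(2) hypF_Y_eq_difference[OF assms])
qed

section \<open>Values of the linear functional on powers of z(1 - z)\<close>

text \<open>Expands (h + n)_p in the Newton basis, sums over k by Chu-Vandermonde for each basis
  element, and recognises the remaining sum over j as \<open>Y\<close>. The normalising factor
  1/(h)_p of the functional is left out here.\<close>

lemma moment_sum:
  assumes len: "length h = length p" and adm: "admissible_lower (Y_lower d h p)"
    and e: "e \<notin> \<int>\<^sub>\<le>\<^sub>0" and ed: "e - d \<notin> \<int>\<^sub>\<le>\<^sub>0"
    and nz: "pochhammer (1 - e + d) (sum_list p) \<noteq> 0"
  shows "(\<Sum>k\<le>t. (- 1) ^ k * of_nat (t choose k) *
      (pochhammer d (t + k) / pochhammer e (t + k) * multi_poch (shift h (of_nat (t + k))) p))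
    = Gamma (e - d) / pochhammer (1 - e + d) (sum_list p) *
      (pochhammer d t * pochhammer (e - d - of_nat (sum_list p)) t / pochhammer e (2 * t)
        * Y d e 0 h p 1 (- 1) (of_nat t))"
proof -
  define P where "P = sum_list p"
  define E where "E j = multi_poch (shift h (- d)) p * hypF (- of_nat j # Y_upper d h) (Y_lower d h p)" for j
  define x where "x = 1 - e + d"
  have *: "pochhammer d n * multi_poch (shift h (of_nat n)) p
      = (\<Sum>j\<le>P. E j / fact j * pochhammer d (n + j))" for n
    by (subst multi_poch_newton[OF len adm])
      (simp add: sum_distrib_left E_def P_def pochhammer_product' mult_ac)
  have "(\<Sum>k\<le>t. (- 1) ^ k * of_nat (t choose k) *
      (pochhammer d (t + k) / pochhammer e (t + k) * multi_poch (shift h (of_nat (t + k))) p))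
    = (\<Sum>k\<le>t. (- 1) ^ k * of_nat (t choose k) *
      ((\<Sum>j\<le>P. E j / fact j * pochhammer d (t + k + j)) / pochhammer e (t + k)))"
    by (simp only: * times_divide_eq_left)
  also have "\<dots> = (\<Sum>k\<le>t. \<Sum>j\<le>P. E j / fact j * ((- 1) ^ k * of_nat (t choose k) *
      (pochhammer d (t + k + j) / pochhammer e (t + k))))"
    by (simp add: sum_distrib_left sum_divide_distrib mult_ac)
  also have "\<dots> = (\<Sum>j\<le>P. E j / fact j * (\<Sum>k\<le>t. (- 1) ^ k * of_nat (t choose k) *
      (pochhammer d (t + k + j) / pochhammer e (t + k))))"
    by (subst sum.swap) (simp add: sum_distrib_left)
  also have "\<dots> = (\<Sum>j\<le>P. E j / fact j *
      (pochhammer d (t + j) * pochhammer (e - d - of_nat j) t / pochhammer e (2 * t)))"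
    by (simp only: alternating_pochhammer_ratio_sum[OF e])
  also have "\<dots> = (\<Sum>j\<le>P. 1 / pochhammer x P *
      (pochhammer d t * pochhammer (e - d - of_nat P) t / pochhammer e (2 * t)) *
      (pochhammer x j / fact j * E j * pochhammer (of_nat t + d) j * pochhammer (x + of_nat j - of_nat t) (P - j)))"
  proof (rule sum.cong[OF refl])
    fix j assume "j \<in> {..P}"
    then have "pochhammer x j * pochhammer (x + of_nat j - of_nat t) (P - j) * pochhammer (e - d - of_nat P) t
       = pochhammer (e - d - of_nat j) t * pochhammer x P"
      using pochhammer_split_shifted[of j P x t] by (simp add: x_def)
    moreover have "pochhammer x P \<noteq> 0"
      using nz by (simp add: x_def P_def)
    ultimately have A: "pochhammer (e - d - of_nat j) t = 1 / pochhammer x P *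
        (pochhammer x j * pochhammer (x + of_nat j - of_nat t) (P - j) * pochhammer (e - d - of_nat P) t)"
      by (simp add: field_simps)
    show "E j / fact j *
      (pochhammer d (t + j) * pochhammer (e - d - of_nat j) t / pochhammer e (2 * t)) =
       1 / pochhammer x P *
      (pochhammer d t * pochhammer (e - d - of_nat P) t / pochhammer e (2 * t)) *
      (pochhammer x j / fact j * E j * pochhammer (of_nat t + d) j * pochhammer (x + of_nat j - of_nat t) (P - j))"
      unfolding A pochhammer_product'[of d t j] by (simp add: add.commute mult_ac)
  qed
  also have "\<dots> = 1 / pochhammer x P *
      (pochhammer d t * pochhammer (e - d - of_nat P) t / pochhammer e (2 * t)) *
      (\<Sum>j\<le>P. pochhammer x j / fact j * E j * pochhammer (of_nat t + d) j * pochhammer (x + of_nat j - of_nat t) (P - j))"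
    by (simp only: sum_distrib_left)
  also have "(\<Sum>j\<le>P. pochhammer x j / fact j * E j * pochhammer (of_nat t + d) j * pochhammer (x + of_nat j - of_nat t) (P - j))
      = Gamma (e - d) * Y d e 0 h p 1 (- 1) (of_nat t)"
  proof -
    have "Gamma (e - d) \<noteq> 0"
      using ed by (simp add: Gamma_eq_zero_iff)
    then have "Gamma (e - d) * Y d e 0 h p 1 (- 1) (of_nat t) = multi_poch (shift h (- d)) p *
     (\<Sum>j=0..P.
        pochhammer (d - e + 1) j / fact j *
        hypF (- of_nat j # Y_upper d h) (Y_lower d h p) *
        pochhammer (of_nat t + d) j *
        pochhammer (- of_nat t + d - e + of_nat j + 1) (P - j))"
      by (simp add: Y_def P_def)
    also have "\<dots> = (\<Sum>j\<le>P. pochhammer x j / fact j * E j * pochhammer (of_nat t + d) j * pochhammer (x + of_nat j - of_nat t) (P - j))"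
      unfolding sum_distrib_left atLeast0AtMost
      by (intro sum.cong refl) (simp add: E_def x_def algebra_simps)
    finally show ?thesis ..
  qed
  finally show ?thesis
    by (simp add: x_def P_def)
qed

section \<open>Interchange of summation and comparison of the two series\<close>

lemma sum_convolution_eq_triangular:
  fixes A L :: "nat \<Rightarrow> 'a::comm_ring_1" and w :: "nat \<Rightarrow> nat \<Rightarrow> 'a"
  assumes w: "\<And>i n. n < i \<or> n > 2 * i \<Longrightarrow> w i n = 0"
    and z: "\<And>i n. n > M \<Longrightarrow> A i * w i n * L n = 0"
  shows "(\<Sum>n\<le>M. (\<Sum>i\<le>n. A i * w i n) * L n) = (\<Sum>i\<le>M. A i * (\<Sum>k\<le>i. w i (i + k) * L (i + k)))"
proof -
  have "(\<Sum>n\<le>M. (\<Sum>i\<le>n. A i * w i n) * L n) = (\<Sum>n\<le>M. \<Sum>i\<le>M. A i * w i n * L n)"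
    unfolding sum_distrib_right by (intro sum.cong refl sum.mono_neutral_left) (auto simp: w)
  also have "\<dots> = (\<Sum>i\<le>M. \<Sum>n\<le>M. A i * w i n * L n)"
    by (rule sum.swap)
  also have "\<dots> = (\<Sum>i\<le>M. \<Sum>n=i..2 * i. A i * w i n * L n)"
  proof (rule sum.cong[OF refl])
    fix i
    \<comment> \<open>Rows with 2i > M would be cut short by the bound M; \<open>z\<close> allows
      widening the range until it covers the whole support i, ..., 2i of \<open>w i\<close>.\<close>
    have "(\<Sum>n\<le>M. A i * w i n * L n) = (\<Sum>n\<le>max M (2 * i). A i * w i n * L n)"
      by (intro sum.mono_neutral_left) (auto simp: z)
    also have "\<dots> = (\<Sum>n=i..2 * i. A i * w i n * L n)"
      by (intro sum.mono_neutral_right) (auto simp: w)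
    finally show "(\<Sum>n\<le>M. A i * w i n * L n) = (\<Sum>n=i..2 * i. A i * w i n * L n)" .
  qed
  also have "\<dots> = (\<Sum>i\<le>M. \<Sum>k\<le>i. A i * w i (i + k) * L (i + k))"
    proof (rule sum.cong[OF refl])
    fix i
    show "(\<Sum>n=i..2 * i. A i * w i n * L n) = (\<Sum>k\<le>i. A i * w i (i + k) * L (i + k))"
      by (rule sum.reindex_bij_witness[of _ "\<lambda>k. i + k" "\<lambda>n. n - i"]) auto
  qed
  finally show ?thesis
    by (simp add: sum_distrib_left mult.assoc)
qed

theorem mainTheorem11:
  fixes l :: nat and p :: "nat list" and h :: "complex list" and a b d e :: complex
  assumes "length p = l" and "length h = l"
    and "terminating ([a, b, d] @ vadd h p)"
    and "terminating [a / 2, b / 2, d, e - d - of_nat (sum_list p)]"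
    and "admissible_lower ([(a + b + 1) / 2, e] @ h)"
    and "admissible_lower ((a + b + 1) / 2 # \<Delta>2 e)"
    and "admissible_lower (Y_lower d h p)"
    and "e - d \<notin> \<int>\<^sub>\<le>\<^sub>0"
    and "pochhammer (1 - e + d) (sum_list p) * multi_poch h p \<noteq> 0"
  shows "hypF ([a, b, d] @ vadd h p) ([(a + b + 1) / 2, e] @ h) =
    Gamma (e - d) / (pochhammer (1 - e + d) (sum_list p) * multi_poch h p) *
    hypF_poly [a / 2, b / 2, d, e - d - of_nat (sum_list p)] ((a + b + 1) / 2 # \<Delta>2 e)
      (\<lambda>t. Y d e 0 h p 1 (- 1) t)"
proof -
  define P where "P = sum_list p"
  define c where "c = a / 2 + b / 2 + 1 / 2"
  \<comment> \<open>\<open>A i\<close> is a coefficient in the variable w = 4z(1 - z),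
    \<open>w i n\<close> the coefficient of z^n in the i-th power of 4z(1 - z), and
    \<open>L n\<close> the functional at z^n times (h)_p.\<close>
  define A where "A i = hyp2F1_fps (a / 2) (b / 2) c $ i" for i
  define w where "w i n = (if n < i then 0 else 4 ^ i * (- 1) ^ (n - i) * of_nat (i choose (n - i)) :: complex)"
    for i n
  define L where "L n = pochhammer d n / pochhammer e n * multi_poch (shift h (of_nat n)) p" for n
  define K where "K = Gamma (e - d) / (pochhammer (1 - e + d) P * multi_poch h p)"
  define lterm where "lterm n = vec_poch ([a, b, d] @ vadd h p) n / (vec_poch ([c, e] @ h) n * fact n)" for n
  define rterm where "rterm n = vec_poch [a / 2, b / 2, d, e - d - of_nat P] n / (vec_poch (c # \<Delta>2 e) n * fact n)
      * Y d e 0 h p 1 (- 1) (of_nat n)" for n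
  have len: "length h = length p"
    using assms by simp
  have c_eq: "(a + b + 1) / 2 = c"
    by (simp add: c_def field_simps)
  have c: "c \<notin> \<int>\<^sub>\<le>\<^sub>0" and e: "e \<notin> \<int>\<^sub>\<le>\<^sub>0" and h: "admissible_lower h"
    using assms(5) by (auto simp: admissible_lower_def c_eq)
  have nz: "pochhammer (1 - e + d) P \<noteq> 0" "multi_poch h p \<noteq> 0"
    using assms(9) by (auto simp: P_def)
  have "K \<noteq> 0"
    using nz assms(8) by (simp add: K_def Gamma_eq_zero_iff)

  \<comment> \<open>The series on the right can thus only terminate through \<open>a / 2\<close>, \<open>b / 2\<close> or \<open>d\<close>, and it does so
    together with the one on the left. For an odd negative \<open>a\<close> the quadratic transformation would
    not be a polynomial identity.\<close>
  have "e - d - of_nat P \<notin> \<int>\<^sub>\<le>\<^sub>0"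
  proof
    assume "e - d - of_nat P \<in> \<int>\<^sub>\<le>\<^sub>0"
    then obtain N where "e - d - of_nat P = - of_nat N"
      by (auto elim: nonpos_Ints_cases')
    then have ed: "e - d = of_nat P - of_nat N"
      by (simp add: algebra_simps)
    have "N < P"
    proof (rule ccontr)
      assume "\<not> N < P"
      then have "e - d = - of_nat (N - P)"
        using ed by (simp add: of_nat_diff)
      with assms(8) show False by simp
    qed
    \<comment> \<open>The index P - N - 1 lies below P, so (1 - e + d)_P contains a zero
      factor.\<close>
    moreover have "1 - e + d = - of_nat (P - N - 1)"
      using ed \<open>N < P\<close> by (simp add: of_nat_diff algebra_simps)
    ultimately have "pochhammer (1 - e + d) P = 0"
      by (auto simp: pochhammer_eq_0_iff intro!: exI[of _ "P - N - 1"])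
    with nz show False by simp
  qed
  then have "a / 2 \<in> \<int>\<^sub>\<le>\<^sub>0 \<or> b / 2 \<in> \<int>\<^sub>\<le>\<^sub>0 \<or> d \<in> \<int>\<^sub>\<le>\<^sub>0"
    using assms(4) by (auto simp: terminating_def P_def)
  \<comment> \<open>If d = -m, then \<open>L\<close> vanishes beyond m. If a/2 or b/2 is -m, then
    \<open>A\<close> vanishes beyond m and \<open>w i\<close> beyond 2i, so M = 2m works.\<close>
  then obtain M where M: "\<And>i n. n > M \<Longrightarrow> A i * w i n * L n = 0"
  proof (elim disjE nonpos_Ints_cases')
    fix m assume m: "d = - of_nat m"
    show thesis
      by (rule that[of m]) (auto simp: L_def m pochhammer_of_nat_eq_0_iff)
  next
    fix m assume "a / 2 = - of_nat m"
    then have "A i * w i n * L n = 0" if "n > 2 * m" for i n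
      using that by (cases "i > m") (auto simp: A_def w_def hyp2F1_fps_def pochhammer_of_nat_eq_0_iff)
    then show thesis by (rule that)
  next
    fix m assume "b / 2 = - of_nat m"
    then have "A i * w i n * L n = 0" if "n > 2 * m" for i n
      using that by (cases "i > m") (auto simp: A_def w_def hyp2F1_fps_def pochhammer_of_nat_eq_0_iff)
    then show thesis by (rule that)
  qed

  have l: "lterm n = (\<Sum>i\<le>n. A i * w i n) * L n / multi_poch h p" for n
  proof -
    have "(\<Sum>i\<le>n. A i * w i n) = hyp2F1_fps a b c $ n"
      using hyp2F1_fps_quadratic_coeff[of "a / 2" "b / 2" n] c by (simp add: A_def w_def c_def)
    moreover have "vec_poch (vadd h p) n = vec_poch h n * multi_poch (shift h (of_nat n)) p / multi_poch h p"
      using vec_poch_vadd[OF len, of n] nz by (simp add: field_simps)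
    ultimately show ?thesis
      using vec_poch_nonzero[OF h, of n] by (simp add: lterm_def hyp2F1_fps_def L_def mult_ac)
  qed
  have r: "K * rterm i = A i * (\<Sum>k\<le>i. w i (i + k) * L (i + k)) / multi_poch h p" for i
  proof -
    \<comment> \<open>Duplication produces the lower parameters \<open>\<Delta>2 e\<close>, and its
      4^i cancels the one from (4z(1 - z))^i.\<close>
    have e2: "pochhammer e (2 * i) = 4 ^ i * pochhammer (e / 2) i * pochhammer ((e + 1) / 2) i"
      using pochhammer_double[of "e / 2" i] by (simp add: power_mult add_divide_distrib)
    have "(\<Sum>k\<le>i. w i (i + k) * L (i + k)) = 4 ^ i * (\<Sum>k\<le>i. (- 1) ^ k * of_nat (i choose k) *
      (pochhammer d (i + k) / pochhammer e (i + k) * multi_poch (shift h (of_nat (i + k))) p))"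
      unfolding sum_distrib_left by (intro sum.cong refl) (simp add: w_def L_def)
    also have "\<dots> = 4 ^ i * (Gamma (e - d) / pochhammer (1 - e + d) P *
      (pochhammer d i * pochhammer (e - d - of_nat P) i / pochhammer e (2 * i)
        * Y d e 0 h p 1 (- 1) (of_nat i)))"
      using moment_sum[OF len assms(7) e assms(8)] nz by (simp add: P_def)
    finally show ?thesis
      unfolding e2 by (simp add: K_def rterm_def A_def hyp2F1_fps_def \<Delta>2_def mult_ac)
  qed

  have "lterm sums (\<Sum>n\<le>M. lterm n)"
  proof (rule sums_finite)
    fix n assume "n \<notin> {..M}"
    then show "lterm n = 0"
      by (simp add: l sum_distrib_right M)
  qed simp
  moreover have "(\<lambda>i. K * rterm i) sums (\<Sum>i\<le>M. K * rterm i)"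
  proof (rule sums_finite)
    fix i assume "i \<notin> {..M}"
    \<comment> \<open>All indices i + k in \<open>r\<close> exceed M as well.\<close>
    then show "K * rterm i = 0"
      by (simp add: r sum_distrib_left M flip: mult.assoc)
  qed simp
  moreover have "(\<Sum>n\<le>M. lterm n) = (\<Sum>i\<le>M. K * rterm i)"
  proof -
    have "w i n = 0" if "n < i \<or> n > 2 * i" for i n
      using that by (auto simp: w_def binomial_eq_0)
    from sum_convolution_eq_triangular[of w M A L, OF this M] show ?thesis
      by (simp add: l r flip: sum_divide_distrib)
  qed
  ultimately have "suminf lterm = (\<Sum>i. K * rterm i)"
    by (simp add: sums_iff)
  \<comment> \<open>Finite support was shown for \<open>K * rterm\<close>; dividing by
    \<open>K\<close>, which is nonzero, makes \<open>rterm\<close> itself summable.\<close>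
  also have "\<dots> = K * suminf rterm"
    using \<open>(\<lambda>i. K * rterm i) sums _\<close> \<open>K \<noteq> 0\<close>
    by (intro suminf_mult) (auto simp: sums_iff summable_mult_D)
  finally show ?thesis
    unfolding hypF_def hypF_poly_def lterm_def rterm_def K_def P_def c_eq by simp
qed

end
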